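(* Let $n \ge 1$ and let $i$ be an integer with $1 \le i < 3^n$. Then $\binom{3i}{i-1} \not\equiv 0 \pmod 3$ if and only if $i = (3^k - 1)/2$ for some $k \in \{1, 2, \dots, n\}$. *)

theory Defs
  imports Complex_Main "HOL-Number_Theory.Cong"
begin

end

(* With f i = (3i choose i-1), absorption gives 3 dvd f i unless i = 3b+1, and for b >= 1 Lucas's
   congruence yields f (3b+1) = (3(3b+1) choose 3b) \<equiv> (3b+1 choose b) = (3b choose b) + f b \<equiv> f b,
   since 3 divides (3b choose b).  As f 1 = 1, the indices with f i nonzero modulo 3 are exactly the
   iterates of b \<mapsto> 3b+1 starting from 1, i.e. those i for which 2i+1 is a power of 3. *)
theory Submission
  imports Defs
begin

text \<open>Binomial form of (1+x)^3 \<equiv> 1+x^3 modulo 3: Pascal's rule applied three times has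
  coefficients 1, 3, 3, 1, and the middle two vanish.\<close>

lemma lucas_step_3: "[(3 * a) choose (3 * b) = a choose b] (mod 3)" for a b :: nat
proof (induction a arbitrary: b)
  case 0
  then show ?case by (cases "b = 0") (simp_all add: binomial_eq_0)
next
  case (Suc a)
  show ?case
  proof (cases b)
    case 0
    then show ?thesis by simp
  next
    case (Suc c)
    have "(3 * Suc a) choose (3 * Suc c) = ((3 * a) choose (3 * Suc c)) + ((3 * a) choose (3 * c))
        + 3 * (((3 * a) choose (3 * c + 2)) + ((3 * a) choose (3 * c + 1)))"
      by (simp add: numeral_eq_Suc)
    also have "[\<dots> = ((3 * a) choose (3 * Suc c)) + ((3 * a) choose (3 * c))] (mod 3)"
      unfolding cong_def by (rule mod_mult_self2)
    also have "[((3 * a) choose (3 * Suc c)) + ((3 * a) choose (3 * c)) = (a choose Suc c) + (a choose c)] (mod 3)"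
      by (intro cong_add Suc.IH)
    finally show ?thesis
      by (simp add: Suc add.commute)
  qed
qed

lemma three_dvd_choose:
  fixes a k :: nat
  assumes "\<not> 3 dvd k"
  shows "3 dvd (3 * a) choose k"
proof -
  have "k * ((3 * a) choose k) = 3 * (a * ((3 * a - 1) choose (k - 1)))"
    using times_binomial_minus1_eq[of k "3 * a"] assms by (cases k) auto
  then have "3 dvd k * ((3 * a) choose k)" by simp
  moreover have "prime (3::nat)" by simp
  ultimately show ?thesis using assms prime_dvd_multD by blast
qed

lemma three_dvd_choose_third:
  fixes b :: nat
  assumes "b \<ge> 1"
  shows "3 dvd (3 * b) choose b"
proof -
  have "b * ((3 * b) choose b) = b * (3 * ((3 * b - 1) choose (b - 1)))"
    using times_binomial_minus1_eq[of b "3 * b"] assms by simp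
  with assms show ?thesis by simp
qed

lemma choose_pred_step_cong:
  fixes b :: nat
  assumes "b \<ge> 1"
  shows "[(3 * (3 * b + 1)) choose (3 * b) = (3 * b) choose (b - 1)] (mod 3)"
proof -
  have "(3 * b + 1) choose b = ((3 * b) choose b) + ((3 * b) choose (b - 1))"
    using choose_reduce_nat[of "3 * b + 1" b] assms by simp
  also have "[\<dots> = 0 + ((3 * b) choose (b - 1))] (mod 3)"
    using three_dvd_choose_third[OF assms] by (intro cong_add) (simp_all add: cong_0_iff)
  finally show ?thesis
    using lucas_step_3[of "3 * b + 1" b] cong_trans by auto
qed

text \<open>The exponent is left unbounded so that the strong induction need not track
  \<open>n\<close>.\<close>

lemma choose_pred_not_cong_0_iff:
  fixes i :: nat
  assumes "i \<ge> 1"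
  shows "\<not> [(3 * i) choose (i - 1) = 0] (mod 3) \<longleftrightarrow> (\<exists>k. 2 * i + 1 = 3 ^ k)"
  using assms
proof (induction i rule: less_induct)
  case (less i)
  consider "i = 1" | b where "i = 3 * b + 1" "b \<ge> 1" | "\<not> 3 dvd i - 1"
    using less.prems by (metis One_nat_def Suc_eq_plus1 Suc_pred' dvdE less_eq_Suc_le mult_0_right
        not_less_eq_eq add_0 le_0_eq)
  then show ?case
  proof cases
    case 1
    then show ?thesis by (auto simp: cong_def intro: exI[of _ 1])
  next
    case (2 b)
    have "[(3 * i) choose (i - 1) = 0] (mod 3) \<longleftrightarrow> [(3 * b) choose (b - 1) = 0] (mod 3)"
      using choose_pred_step_cong[of b] 2 by (simp add: cong_def)
    \<comment> \<open>Since 2(3b+1)+1 = 3(2b+1), passing from \<open>b\<close> to \<open>i\<close>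
      raises the exponent by one.\<close>
    moreover have "(\<exists>k. 2 * i + 1 = 3 ^ k) \<longleftrightarrow> (\<exists>k. 2 * b + 1 = (3::nat) ^ k)"
    proof
      assume "\<exists>k. 2 * i + 1 = 3 ^ k"
      then obtain k where k: "2 * i + 1 = 3 ^ k" ..
      with 2 obtain j where "k = Suc j" by (cases k) auto
      with k 2 have "2 * b + 1 = 3 ^ j" by simp
      then show "\<exists>k. 2 * b + 1 = (3::nat) ^ k" ..
    next
      assume "\<exists>k. 2 * b + 1 = (3::nat) ^ k"
      then obtain k where "2 * b + 1 = (3::nat) ^ k" ..
      with 2 have "2 * i + 1 = 3 ^ Suc k" by simp
      then show "\<exists>k. 2 * i + 1 = 3 ^ k" ..
    qed
    ultimately show ?thesis using less.IH[of b] 2 by simp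
  next
    case 3
    have "2 * i + 1 \<noteq> 3 ^ k" for k
    proof
      assume k: "2 * i + 1 = 3 ^ k"
      with less.prems obtain j where "k = Suc j" by (cases k) auto
      with k have "3 dvd 2 * i + 1" by simp
      \<comment> \<open>Modulo 3, 2i+1 vanishes only for i \<equiv> 1.\<close>
      with 3 show False by presburger
    qed
    with three_dvd_choose[OF 3] show ?thesis by (auto simp: cong_0_iff)
  qed
qed

theorem theorem3:
  fixes n i :: nat
  assumes "n \<ge> 1" and "1 \<le> i" and "i < 3 ^ n"
  shows "\<not> [(3 * i) choose (i - 1) = 0] (mod 3) \<longleftrightarrow> (\<exists>k\<in>{1..n}. i = (3 ^ k - 1) div 2)"
proof -
  have half: "2 * i + 1 = 3 ^ k \<longleftrightarrow> i = (3 ^ k - 1) div 2" for k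
  proof -
    \<comment> \<open>Oddness makes the truncating \<open>div 2\<close> exact.\<close>
    have "odd ((3::nat) ^ k)" by simp
    then show ?thesis by presburger
  qed
  have "k \<in> {1..n}" if k: "2 * i + 1 = 3 ^ k" for k
  proof -
    \<comment> \<open>From i \<le> 3^n - 1 follows 2i+1 \<le> 2*3^n - 1 < 3^(n+1); the exponent 0
      would force i = 0.\<close>
    have "(3::nat) ^ k < 3 ^ Suc n" using k assms(3) by simp
    then have "k < Suc n" by (rule power_less_imp_less_exp[rotated]) simp
    moreover have "k \<noteq> 0" using k assms(2) by (cases k) auto
    ultimately show ?thesis by simp
  qed
  then show ?thesis
    unfolding choose_pred_not_cong_0_iff[OF assms(2)] using half by blast
qed

end
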